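(* Let $g_{ij}$ be the fundamental metrical d-tensor of the rheonomic Berwald-Moór metric $\mathring F(t,y)=\sqrt{h^{11}(t)}\,\sqrt[4]{y_1^1y_1^2y_1^3y_1^4}$. Then the Cartan canonical $\mathring\Gamma$-linear connection produced by $\mathring F$ has the adapted local components $$C\mathring\Gamma=\left(\varkappa_{11}^1,\ G_{j1}^k=0,\ L_{jk}^i=\frac{\varkappa_{11}^1}{3}C_{j(k)}^{i(1)},\ C_{j(k)}^{i(1)}\right),$$ where, for all $i,j,k\in\{1,2,3,4\}$ (no summation), $$C_{j(k)}^{i(1)}=A_{jk}^i\cdot\frac{y_1^i}{y_1^jy_1^k},\qquad A_{jk}^i=\frac{2\delta_j^i+2\delta_k^i+2\delta_{jk}-8\delta_j^i\delta_{jk}-1}{8}.$$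
   Context: All indices $i,j,k,m,p,\dots$ run from $1$ to $4$; repeated indices are summed unless "no summation" is stated; $\delta$ with two indices is the Kronecker symbol. Let $h_{11}:\mathbb{R}\to(0,\infty)$ be a smooth function (a Riemannian metric on $\mathbb{R}$), $h^{11}=1/h_{11}$, and $\varkappa_{11}^1=\frac{h^{11}}{2}\frac{dh_{11}}{dt}$ its Christoffel symbol. Work in local coordinates $(t,x^i,y_1^i)$ of the $1$-jet space $J^1(\mathbb{R},M^4)$, $M^4$ a $4$-dimensional manifold, on the domain where $G_{1111}:=y_1^1y_1^2y_1^3y_1^4>0$. The fundamental metrical d-tensor of $\mathring F$ is $g_{ij}=\frac{h_{11}}{2}\frac{\partial^2\mathring F^2}{\partial y_1^i\partial y_1^j}$, and $(g^{jk})$ denotes the inverse matrix of $(g_{ij})$. The nonlinear connection used is $\mathring\Gamma=\left(M_{(1)1}^{(i)}=-\varkappa_{11}^1y_1^i,\ N_{(1)j}^{(i)}=-\frac{\varkappa_{11}^1}{3}\delta_j^i\right)$, with adapted vector fields $$\frac{\delta}{\delta t}=\frac{\partial}{\partial t}+\varkappa_{11}^1y_1^p\frac{\partial}{\partial y_1^p},\qquad \frac{\delta}{\delta x^i}=\frac{\partial}{\partial x^i}+\frac{\varkappa_{11}^1}{3}\frac{\partial}{\partial y_1^i},\qquad \frac{\partial}{\partial y_1^i}.$$ The Cartan canonical $\mathring\Gamma$-linear connection is $C\mathring\Gamma=(\varkappa_{11}^1,G_{j1}^k,L_{jk}^i,C_{j(k)}^{i(1)})$, whose first component is the Christoffel symbol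 of $h_{11}$ and whose other adapted components are given by $$G_{j1}^k=\frac{g^{km}}{2}\frac{\delta g_{mj}}{\delta t},\qquad L_{jk}^i=\frac{g^{im}}{2}\left(\frac{\delta g_{jm}}{\delta x^k}+\frac{\delta g_{km}}{\delta x^j}-\frac{\delta g_{jk}}{\delta x^m}\right),$$ $$C_{j(k)}^{i(1)}=\frac{g^{im}}{2}\left(\frac{\partial g_{jm}}{\partial y_1^k}+\frac{\partial g_{km}}{\partial y_1^j}-\frac{\partial g_{jk}}{\partial y_1^m}\right).$$ *)

theory Defs
  imports "HOL-Analysis.Analysis"
begin

(* A function of the local coordinates (t, x^i, y_1^i) of J^1(R, M^4), in this order.
   The index range 1,...,4 is the numeral type 4, whose elements are 1, 2, 3 and 4 = 0. *)
type_synonym jet_fun = "real \<Rightarrow> real ^ 4 \<Rightarrow> real ^ 4 \<Rightarrow> real"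

definition smooth :: "(real \<Rightarrow> real) \<Rightarrow> bool" where
  "smooth f \<longleftrightarrow> (\<forall>n. (deriv ^^ n) f differentiable_on UNIV)"

definition kronecker :: "4 \<Rightarrow> 4 \<Rightarrow> real" where
  "kronecker i j = (if i = j then 1 else 0)"

definition upd_coord :: "real ^ 4 \<Rightarrow> 4 \<Rightarrow> real \<Rightarrow> real ^ 4" where
  "upd_coord v i s = (\<chi> m. if m = i then s else v $ m)"

definition pd_t :: "jet_fun \<Rightarrow> jet_fun" where
  "pd_t f t x y = deriv (\<lambda>s. f s x y) t"

definition pd_x :: "4 \<Rightarrow> jet_fun \<Rightarrow> jet_fun" where
  "pd_x i f t x y = deriv (\<lambda>s. f t (upd_coord x i s) y) (x $ i)"

definition pd_y :: "4 \<Rightarrow> jet_fun \<Rightarrow> jet_fun" where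
  "pd_y i f t x y = deriv (\<lambda>s. f t x (upd_coord y i s)) (y $ i)"

(* The Christoffel symbol \<kappa>_{11}^1 of the metric h_{11} on the real line, with h^{11} = 1 / h_{11}. *)
definition christoffel :: "(real \<Rightarrow> real) \<Rightarrow> real \<Rightarrow> real" where
  "christoffel h t = (1 / h t) / 2 * deriv h t"

(* nl_M i is M_{(1)1}^{(i)} and nl_N i j is N_{(1)j}^{(i)}. *)
record nonlinear_connection =
  nl_M :: "4 \<Rightarrow> jet_fun"
  nl_N :: "4 \<Rightarrow> 4 \<Rightarrow> jet_fun"

definition Gamma_ring :: "(real \<Rightarrow> real) \<Rightarrow> nonlinear_connection" where
  "Gamma_ring h =
    \<lparr>nl_M = (\<lambda>i t x y. - christoffel h t * y $ i),
     nl_N = (\<lambda>i j t x y. - (christoffel h t / 3) * kronecker i j)\<rparr>"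

definition delta_t :: "nonlinear_connection \<Rightarrow> jet_fun \<Rightarrow> jet_fun" where
  "delta_t \<Gamma> f t x y = pd_t f t x y - (\<Sum>p\<in>UNIV. nl_M \<Gamma> p t x y * pd_y p f t x y)"

definition delta_x :: "nonlinear_connection \<Rightarrow> 4 \<Rightarrow> jet_fun \<Rightarrow> jet_fun" where
  "delta_x \<Gamma> i f t x y = pd_x i f t x y - (\<Sum>p\<in>UNIV. nl_N \<Gamma> p i t x y * pd_y p f t x y)"

lemma delta_t_Gamma_ring:
  "delta_t (Gamma_ring h) f t x y =
    pd_t f t x y + christoffel h t * (\<Sum>p\<in>UNIV. y $ p * pd_y p f t x y)"
  by (simp add: delta_t_def Gamma_ring_def sum_distrib_left sum_negf mult.assoc)

lemma delta_x_Gamma_ring: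
  "delta_x (Gamma_ring h) i f t x y = pd_x i f t x y + christoffel h t / 3 * pd_y i f t x y"
proof -
  have "(\<Sum>p\<in>UNIV. - (christoffel h t / 3) * kronecker p i * pd_y p f t x y)
      = (\<Sum>p\<in>UNIV. if p = i then - (christoffel h t / 3) * pd_y p f t x y else 0)"
    by (rule sum.cong) (auto simp: kronecker_def)
  then show ?thesis
    by (simp add: delta_x_def Gamma_ring_def)
qed

(* The fundamental metrical d-tensor g_{ij} produced by F, as a 4 x 4 matrix. *)
definition metric :: "(real \<Rightarrow> real) \<Rightarrow> jet_fun \<Rightarrow> real \<Rightarrow> real ^ 4 \<Rightarrow> real ^ 4 \<Rightarrow> real ^ 4 ^ 4" where
  "metric h F t x y =
    (\<chi> i j. h t / 2 * pd_y i (pd_y j (\<lambda>t x y. (F t x y)\<^sup>2)) t x y)"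

definition g_low :: "(real \<Rightarrow> real) \<Rightarrow> jet_fun \<Rightarrow> 4 \<Rightarrow> 4 \<Rightarrow> jet_fun" where
  "g_low h F i j t x y = metric h F t x y $ i $ j"

definition g_up :: "(real \<Rightarrow> real) \<Rightarrow> jet_fun \<Rightarrow> 4 \<Rightarrow> 4 \<Rightarrow> jet_fun" where
  "g_up h F j k t x y = matrix_inv (metric h F t x y) $ j $ k"

(* Adapted components of a \<Gamma>-linear connection, upper index first:
   conn_H is \<kappa>_{11}^1, conn_G k j is G_{j1}^k, conn_L i j k is L_{jk}^i,
   and conn_C i j k is C_{j(k)}^{i(1)}. *)
record linear_connection =
  conn_H :: jet_fun
  conn_G :: "4 \<Rightarrow> 4 \<Rightarrow> jet_fun"
  conn_L :: "4 \<Rightarrow> 4 \<Rightarrow> 4 \<Rightarrow> jet_fun"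
  conn_C :: "4 \<Rightarrow> 4 \<Rightarrow> 4 \<Rightarrow> jet_fun"

definition cartan_connection ::
    "nonlinear_connection \<Rightarrow> (real \<Rightarrow> real) \<Rightarrow> jet_fun \<Rightarrow> linear_connection" where
  "cartan_connection \<Gamma> h F =
    \<lparr>conn_H = (\<lambda>t x y. christoffel h t),
     conn_G = (\<lambda>k j t x y.
       \<Sum>m\<in>UNIV. g_up h F k m t x y / 2 * delta_t \<Gamma> (g_low h F m j) t x y),
     conn_L = (\<lambda>i j k t x y.
       \<Sum>m\<in>UNIV. g_up h F i m t x y / 2 *
         (delta_x \<Gamma> k (g_low h F j m) t x y + delta_x \<Gamma> j (g_low h F k m) t x y
          - delta_x \<Gamma> m (g_low h F j k) t x y)),
     conn_C = (\<lambda>i j k t x y.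
       \<Sum>m\<in>UNIV. g_up h F i m t x y / 2 *
         (pd_y k (g_low h F j m) t x y + pd_y j (g_low h F k m) t x y
          - pd_y m (g_low h F j k) t x y))\<rparr>"

definition G1111 :: "real ^ 4 \<Rightarrow> real" where
  "G1111 y = y $ 1 * y $ 2 * y $ 3 * y $ 4"

definition berwald_moor :: "(real \<Rightarrow> real) \<Rightarrow> jet_fun" where
  "berwald_moor h t x y = sqrt (1 / h t) * root 4 (G1111 y)"

definition A_coeff :: "4 \<Rightarrow> 4 \<Rightarrow> 4 \<Rightarrow> real" where
  "A_coeff i j k =
    (2 * kronecker i j + 2 * kronecker i k + 2 * kronecker j k
      - 8 * kronecker i j * kronecker j k - 1) / 8"

end

theory Submission
  imports Defs
begin

text \<open>
  On the domain \<open>G1111 y > 0\<close> the squared metric is \<open>F\<^sup>2 = S / h\<close> with \<open>S = sqrt (G1111 y)\<close>, and the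
  logarithmic derivative of \<open>S\<close> in the direction \<open>y\<^sub>k\<close> is \<open>1 / (2 y\<^sub>k)\<close>. Every function
  differentiated below is, up to a factor not depending on \<open>y\<close>, of the form \<open>S\<close>, \<open>S / y\<^sub>i\<close> or
  \<open>S / (y\<^sub>i y\<^sub>j)\<close>, so each differentiation only multiplies by \<open>1 / y\<^sub>k\<close> and a combination of
  Kronecker symbols. In this way
    \<open>g\<^sub>i\<^sub>j = (1 - 2 \<delta>\<^sub>i\<^sub>j) S / (8 y\<^sub>i y\<^sub>j)\<close>,
  where the factor \<open>h / 2\<close> in the definition of the metric has cancelled the \<open>1 / h\<close>: the tensor
  depends on neither \<open>t\<close> nor \<open>x\<close>. Up to the factor \<open>S / 8\<close> and a
  scaling of row and column \<open>i\<close> by \<open>1 / y\<^sub>i\<close>, it is \<open>J - 2 I\<close>, with \<open>J\<close> the all-ones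
  matrix of size 4, and \<open>J\<^sup>2 = 4 J\<close> gives \<open>(J - 2 I)\<^sup>2 = 4 I\<close>, whence the inverse
    \<open>g\<^sup>j\<^sup>k = 2 (1 - 2 \<delta>\<^sub>j\<^sub>k) y\<^sub>j y\<^sub>k / S\<close>.

  The formulas for the connection follow. As \<open>g\<close> does not depend on \<open>t\<close>, the derivative \<open>\<delta>g/\<delta>t\<close> is
  \<open>\<kappa>\<close> times the Euler operator \<open>\<Sum>\<^sub>p y\<^sub>p \<partial>/\<partial>y\<^sub>p\<close> applied to \<open>g\<close>, which vanishes since \<open>g\<close> is
  homogeneous of degree 0 in \<open>y\<close>. As \<open>g\<close> does not depend on \<open>x\<close>, \<open>\<delta>g/\<delta>x\<^sup>k\<close> is
  \<open>\<kappa>/3\<close> times \<open>\<partial>g/\<partial>y\<^sub>k\<close>, so \<open>L\<close> is \<open>\<kappa>/3\<close> times \<open>C\<close> term by term. In \<open>C\<close> all powers of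
  \<open>S\<close> and of the summation variable \<open>y\<^sub>m\<close> cancel, leaving \<open>y\<^sub>i / (y\<^sub>j y\<^sub>k)\<close>
  times a sum over \<open>m\<close> of Kronecker symbols, which is \<open>A_coeff i j k\<close>.
\<close>

section \<open>Partial derivatives on the domain\<close>

lemma nonzero_coord:
  assumes "G1111 y > 0"
  shows "y $ i \<noteq> 0"
proof -
  have "y $ 1 \<noteq> 0 \<and> y $ 2 \<noteq> 0 \<and> y $ 3 \<noteq> 0 \<and> y $ 4 \<noteq> 0"
    using assms by (auto simp: G1111_def)
  then have "\<forall>i. y $ i \<noteq> 0"
    unfolding forall_4 .
  then show ?thesis by blast
qed

lemma upd_coord_same [simp]: "upd_coord y k (y $ k) = y"
  by (simp add: upd_coord_def vec_eq_iff)

lemma G1111_upd_coord: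
  assumes "G1111 y > 0"
  shows "G1111 (upd_coord y k s) = s * (G1111 y / y $ k)"
proof -
  have "\<forall>k. y $ k \<noteq> 0 \<longrightarrow> G1111 (upd_coord y k s) = s * (G1111 y / y $ k)"
    unfolding forall_4 by (simp add: G1111_def upd_coord_def)
  with nonzero_coord[OF assms] show ?thesis by blast
qed

lemma DERIV_coord:
  "((\<lambda>s. upd_coord y k s $ i) has_real_derivative kronecker i k) (at s)"
  by (cases "i = k") (auto simp: upd_coord_def kronecker_def)

lemma DERIV_sqrt_G1111:
  assumes "G1111 y > 0"
  shows "((\<lambda>s. sqrt (G1111 (upd_coord y k s))) has_real_derivative sqrt (G1111 y) / (2 * y $ k))
    (at (y $ k))"
proof -
  have "((\<lambda>s. s * (G1111 y / y $ k)) has_real_derivative G1111 y / y $ k) (at (y $ k))"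
    using nonzero_coord[OF assms, of k] by (auto intro!: derivative_eq_intros)
  then have "((\<lambda>s. sqrt (s * (G1111 y / y $ k))) has_real_derivative
      (inverse (sqrt (y $ k * (G1111 y / y $ k))) / 2) * (G1111 y / y $ k)) (at (y $ k))"
    by (intro DERIV_chain2[OF DERIV_real_sqrt]) (use assms nonzero_coord[OF assms, of k] in auto)
  moreover have "(inverse (sqrt (y $ k * (G1111 y / y $ k))) / 2) * (G1111 y / y $ k)
      = (G1111 y / sqrt (G1111 y)) / (2 * y $ k)"
    using nonzero_coord[OF assms, of k] by (simp add: field_simps)
  moreover have "G1111 y / sqrt (G1111 y) = sqrt (G1111 y)"
    using assms by (simp add: real_div_sqrt)
  ultimately show ?thesis
    by (simp only: G1111_upd_coord[OF assms])
qed

text \<open>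
  Up to factors that do not depend on \<open>y\<close>, the first of the following two quotients is a first
  derivative of \<open>F\<^sup>2\<close> and the second an entry of the metric, so that the two lemmas give
  the metric and its derivatives.
\<close>
lemma DERIV_sqrt_G1111_quotient:
  assumes "G1111 y > 0"
  shows "((\<lambda>s. sqrt (G1111 (upd_coord y k s)) / upd_coord y k s $ i) has_real_derivative
    (1 - 2 * kronecker i k) * sqrt (G1111 y) / (2 * y $ i * y $ k)) (at (y $ k))"
proof -
  note nz = nonzero_coord[OF assms]
  have "((\<lambda>s. sqrt (G1111 (upd_coord y k s)) / upd_coord y k s $ i) has_real_derivative
    (sqrt (G1111 y) / (2 * y $ k) * y $ i - sqrt (G1111 y) * kronecker i k) / (y $ i * y $ i))
    (at (y $ k))"
    using DERIV_divide[OF DERIV_sqrt_G1111[OF assms, of k] DERIV_coord[of y k i "y $ k"]] nz by simp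
  moreover have "(sqrt (G1111 y) / (2 * y $ k) * y $ i - sqrt (G1111 y) * kronecker i k)
      / (y $ i * y $ i) = (1 - 2 * kronecker i k) * sqrt (G1111 y) / (2 * y $ i * y $ k)"
    using nz by (auto simp: kronecker_def field_simps)
  ultimately show ?thesis by simp
qed

lemma DERIV_sqrt_G1111_quotient2:
  assumes "G1111 y > 0"
  shows "((\<lambda>s. sqrt (G1111 (upd_coord y k s)) / (upd_coord y k s $ i * upd_coord y k s $ j))
    has_real_derivative (1 - 2 * kronecker i k - 2 * kronecker j k) * sqrt (G1111 y)
      / (2 * y $ i * y $ j * y $ k)) (at (y $ k))"
proof -
  note nz = nonzero_coord[OF assms]
  let ?q = "sqrt (G1111 y) / y $ i"
  let ?q' = "(1 - 2 * kronecker i k) * sqrt (G1111 y) / (2 * y $ i * y $ k)"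
  have "((\<lambda>s. sqrt (G1111 (upd_coord y k s)) / upd_coord y k s $ i / upd_coord y k s $ j)
    has_real_derivative (?q' * y $ j - ?q * kronecker j k) / (y $ j * y $ j)) (at (y $ k))"
    using DERIV_divide[OF DERIV_sqrt_G1111_quotient[OF assms, of k i] DERIV_coord[of y k j "y $ k"]] nz
    by simp
  moreover have "(?q' * y $ j - ?q * kronecker j k) / (y $ j * y $ j)
      = (1 - 2 * kronecker i k - 2 * kronecker j k) * sqrt (G1111 y)
      / (2 * y $ i * y $ j * y $ k)"
    using nz by (auto simp: kronecker_def field_simps)
  ultimately show ?thesis by simp
qed

text \<open>
  A partial derivative at a point of the domain sees only the values on the domain, because the
  domain is open. This lets the closed forms below, valid only for \<open>G1111 y > 0\<close>, be
  differentiated again.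
\<close>
lemma pd_y_eqI:
  assumes y: "G1111 y > 0"
    and eq: "\<And>z. G1111 z > 0 \<Longrightarrow> f t x z = \<phi> z"
    and D: "((\<lambda>s. \<phi> (upd_coord y k s)) has_real_derivative D) (at (y $ k))"
  shows "pd_y k f t x y = D"
proof -
  have "((\<lambda>s. s * (G1111 y / y $ k)) \<longlongrightarrow> y $ k * (G1111 y / y $ k)) (nhds (y $ k))"
    by (intro tendsto_intros filterlim_ident)
  then have "\<forall>\<^sub>F s in nhds (y $ k). s * (G1111 y / y $ k) > 0"
    by (rule order_tendstoD) (use y nonzero_coord[OF y, of k] in simp)
  then have "\<forall>\<^sub>F s in nhds (y $ k). f t x (upd_coord y k s) = \<phi> (upd_coord y k s)"
    by eventually_elim (simp add: eq G1111_upd_coord[OF y])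
  from DERIV_cong_ev[OF refl this refl] D
  have "((\<lambda>s. f t x (upd_coord y k s)) has_real_derivative D) (at (y $ k))"
    by (rule iffD2)
  then show ?thesis
    unfolding pd_y_def by (rule DERIV_imp_deriv)
qed

section \<open>The fundamental metrical d-tensor\<close>

lemma berwald_moor_squared:
  assumes "h t > 0" "G1111 y > 0"
  shows "(berwald_moor h t x y)\<^sup>2 = sqrt (G1111 y) / h t"
proof -
  have "root 4 (G1111 y) = sqrt (sqrt (G1111 y))"
    using real_root_mult_exp[of 2 2 "G1111 y"] by (simp add: sqrt_def)
  with assms show ?thesis
    by (simp add: berwald_moor_def power_mult_distrib)
qed

lemma pd_y_berwald_moor_squared:
  assumes "h t > 0" "G1111 y > 0"
  shows "pd_y j (\<lambda>t x y. (berwald_moor h t x y)\<^sup>2) t x y = sqrt (G1111 y) / (2 * h t * y $ j)"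
  using assms(2)
proof (rule pd_y_eqI)
  show "(berwald_moor h t x z)\<^sup>2 = sqrt (G1111 z) / h t" if "G1111 z > 0" for z
    using assms(1) that by (rule berwald_moor_squared)
  show "((\<lambda>s. sqrt (G1111 (upd_coord y j s)) / h t) has_real_derivative
      sqrt (G1111 y) / (2 * h t * y $ j)) (at (y $ j))"
  proof (rule DERIV_cong)
    show "((\<lambda>s. sqrt (G1111 (upd_coord y j s)) / h t) has_real_derivative
        sqrt (G1111 y) / (2 * y $ j) / h t) (at (y $ j))"
      by (rule DERIV_cdivide[OF DERIV_sqrt_G1111[OF assms(2)]])
  qed simp
qed

lemma pd_y_pd_y_berwald_moor_squared:
  assumes "h t > 0" "G1111 y > 0"
  shows "pd_y i (pd_y j (\<lambda>t x y. (berwald_moor h t x y)\<^sup>2)) t x y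
    = (1 - 2 * kronecker i j) * sqrt (G1111 y) / (4 * h t * y $ i * y $ j)"
  using assms(2)
proof (rule pd_y_eqI)
  show "pd_y j (\<lambda>t x y. (berwald_moor h t x y)\<^sup>2) t x z = sqrt (G1111 z) / (2 * h t * z $ j)"
    if "G1111 z > 0" for z
    using assms(1) that by (rule pd_y_berwald_moor_squared)
  show "((\<lambda>s. sqrt (G1111 (upd_coord y i s)) / (2 * h t * upd_coord y i s $ j))
      has_real_derivative
      (1 - 2 * kronecker i j) * sqrt (G1111 y) / (4 * h t * y $ i * y $ j)) (at (y $ i))"
  proof -
    define c where "c = 1 - 2 * kronecker i j"
    have c: "1 - 2 * kronecker j i = c"
      by (simp add: c_def kronecker_def)
    show ?thesis
      using DERIV_cmult[OF DERIV_sqrt_G1111_quotient[OF assms(2), of i j], of "1 / (2 * h t)"]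
      unfolding c c_def[symmetric] by (simp add: mult_ac)
  qed
qed

lemma g_low_berwald_moor:
  assumes "h t > 0" "G1111 y > 0"
  shows "g_low h (berwald_moor h) i j t x y
    = (1 - 2 * kronecker i j) * sqrt (G1111 y) / (8 * y $ i * y $ j)"
  using assms nonzero_coord[OF assms(2)]
  by (simp add: g_low_def metric_def pd_y_pd_y_berwald_moor_squared)

lemma g_up_berwald_moor:
  assumes "h t > 0" "G1111 y > 0"
  shows "g_up h (berwald_moor h) i j t x y
    = 2 * (1 - 2 * kronecker i j) * y $ i * y $ j / sqrt (G1111 y)"
proof -
  define g where "g = metric h (berwald_moor h) t x y"
  define g' :: "real ^ 4 ^ 4" where
    "g' = (\<chi> i j. 2 * (1 - 2 * kronecker i j) * y $ i * y $ j / sqrt (G1111 y))"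
  note nz = nonzero_coord[OF assms(2)]
  have g: "g $ i $ j = (1 - 2 * kronecker i j) * sqrt (G1111 y) / (8 * y $ i * y $ j)" for i j
    using g_low_berwald_moor[of h t y, OF assms] by (simp add: g_def g_low_def)
  \<comment> \<open>the identity \<open>(J - 2 I)\<^sup>2 = 4 I\<close> for the all-ones matrix \<open>J\<close> of size 4\<close>
  have sq: "(\<Sum>m\<in>UNIV. (1 - 2 * kronecker i m) * (1 - 2 * kronecker m j)) = 4 * kronecker i j"
    for i j
  proof -
    have "\<forall>i j. (\<Sum>m\<in>UNIV. (1 - 2 * kronecker i m) * (1 - 2 * kronecker m j)) = 4 * kronecker i j"
      unfolding forall_4 sum_4 by (simp add: kronecker_def)
    then show ?thesis by blast
  qed
  have "(g ** g') $ i $ j = mat 1 $ i $ j" for i j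
  proof -
    have "(g ** g') $ i $ j
        = (\<Sum>m\<in>UNIV. y $ j / (4 * y $ i) * ((1 - 2 * kronecker i m) * (1 - 2 * kronecker m j)))"
    proof -
      have "a * sqrt (G1111 y) / (8 * y $ i * y $ m) * (2 * b * y $ m * y $ j / sqrt (G1111 y))
          = y $ j / (4 * y $ i) * (a * b)" for a b m
        using assms(2) nz by simp
      then show ?thesis
        by (simp only: matrix_matrix_mult_def vec_lambda_beta g g'_def)
    qed
    also have "\<dots> = y $ j / (4 * y $ i) * (4 * kronecker i j)"
      by (simp only: sq flip: sum_distrib_left)
    also have "\<dots> = mat 1 $ i $ j"
      using nz by (simp add: kronecker_def mat_def)
    finally show ?thesis .
  qed
  then have right: "g ** g' = mat 1"
    by (simp add: vec_eq_iff)
  then have left: "g' ** g = mat 1"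
    by (simp add: matrix_left_right_inverse)
  have "matrix_inv g = g'"
    unfolding matrix_inv_def
  proof (rule some_equality)
    show "A = g'" if "g ** A = mat 1 \<and> A ** g = mat 1" for A
      using that left by (metis matrix_mul_assoc matrix_mul_lid matrix_mul_rid)
  qed (simp add: right left)
  then show ?thesis
    by (simp add: g_up_def g_def g'_def)
qed

section \<open>Derivatives of the metrical d-tensor\<close>

lemma pd_y_g_low:
  assumes "h t > 0" "G1111 y > 0"
  shows "pd_y k (g_low h (berwald_moor h) i j) t x y
    = (1 - 2 * kronecker i j) * (1 - 2 * kronecker i k - 2 * kronecker j k)
        * sqrt (G1111 y) / (16 * y $ i * y $ j * y $ k)"
  using assms(2)
proof (rule pd_y_eqI)
  show "g_low h (berwald_moor h) i j t x z
      = (1 - 2 * kronecker i j) * sqrt (G1111 z) / (8 * z $ i * z $ j)" if "G1111 z > 0" for z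
    using assms(1) that by (rule g_low_berwald_moor)
  show "((\<lambda>s. (1 - 2 * kronecker i j) * sqrt (G1111 (upd_coord y k s))
        / (8 * upd_coord y k s $ i * upd_coord y k s $ j)) has_real_derivative
      (1 - 2 * kronecker i j) * (1 - 2 * kronecker i k - 2 * kronecker j k)
        * sqrt (G1111 y) / (16 * y $ i * y $ j * y $ k)) (at (y $ k))"
  proof -
    define c where "c = 1 - 2 * kronecker i j"
    define d where "d = 1 - 2 * kronecker i k - 2 * kronecker j k"
    show ?thesis
      using DERIV_cmult[OF DERIV_sqrt_G1111_quotient2[OF assms(2), of k i j], of "c / 8"]
      unfolding c_def[symmetric] d_def[symmetric] by (simp add: mult_ac)
  qed
qed

lemma delta_x_g_low:
  assumes "h t > 0" "G1111 y > 0"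
  shows "delta_x (Gamma_ring h) k (g_low h (berwald_moor h) i j) t x y
    = christoffel h t / 3 * pd_y k (g_low h (berwald_moor h) i j) t x y"
  by (simp add: delta_x_Gamma_ring pd_x_def g_low_berwald_moor[of h t y, OF assms])

text \<open>
  The derivative of \<open>g\<^sub>i\<^sub>j\<close> along the Euler field carries the factor
  \<open>\<Sum>\<^sub>p (1 - 2 \<delta>\<^sub>i\<^sub>p - 2 \<delta>\<^sub>j\<^sub>p) = 4 - 2 - 2\<close>, which is how the homogeneity of degree 0 appears.
\<close>
lemma delta_t_g_low:
  assumes "\<And>t. h t > 0" "G1111 y > 0"
  shows "delta_t (Gamma_ring h) (g_low h (berwald_moor h) i j) t x y = 0"
proof -
  have euler: "(\<Sum>p\<in>UNIV. 1 - 2 * kronecker i p - 2 * kronecker j p) = 0"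
  proof -
    have "(\<Sum>p\<in>UNIV. kronecker a p) = 1" for a
      by (simp add: kronecker_def)
    then show ?thesis
      by (simp add: sum_subtractf flip: sum_distrib_left)
  qed
  have "(\<Sum>p\<in>UNIV. y $ p * pd_y p (g_low h (berwald_moor h) i j) t x y)
      = (\<Sum>p\<in>UNIV. (1 - 2 * kronecker i j) * sqrt (G1111 y) / (16 * y $ i * y $ j)
          * (1 - 2 * kronecker i p - 2 * kronecker j p))"
    using nonzero_coord[OF assms(2)] by (intro sum.cong) (simp_all add: pd_y_g_low[of h t y, OF assms])
  also have "\<dots> = 0"
    by (simp only: euler mult_zero_right flip: sum_distrib_left)
  finally show ?thesis
    by (simp add: delta_t_Gamma_ring pd_t_def g_low_berwald_moor[of h _ y, OF assms])
qed

section \<open>The Cartan canonical connection\<close>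

text \<open>
  The coefficient of the vertical component: the sum over \<open>m\<close> in the definition of \<open>C\<close>, after
  cancellation of \<open>S\<close> and \<open>y\<^sub>m\<close>, is an identity between Kronecker symbols, checked for all 64
  index triples.
\<close>
lemma A_coeff_sum:
  "(\<Sum>m\<in>UNIV. (1 - 2 * kronecker i m) / 16 *
      ((1 - 2 * kronecker j m) * (1 - 2 * kronecker j k - 2 * kronecker m k)
     + (1 - 2 * kronecker k m) * (1 - 2 * kronecker k j - 2 * kronecker m j)
     - (1 - 2 * kronecker j k) * (1 - 2 * kronecker j m - 2 * kronecker k m)))
   = A_coeff i j k"
proof -
  have "\<forall>i j k. (\<Sum>m\<in>UNIV. (1 - 2 * kronecker i m) / 16 *
      ((1 - 2 * kronecker j m) * (1 - 2 * kronecker j k - 2 * kronecker m k)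
     + (1 - 2 * kronecker k m) * (1 - 2 * kronecker k j - 2 * kronecker m j)
     - (1 - 2 * kronecker j k) * (1 - 2 * kronecker j m - 2 * kronecker k m)))
   = A_coeff i j k"
    unfolding forall_4 sum_4 by (simp add: kronecker_def A_coeff_def)
  then show ?thesis by blast
qed

lemma conn_C_berwald_moor:
  assumes "h t > 0" "G1111 y > 0"
  shows "conn_C (cartan_connection \<Gamma> h (berwald_moor h)) i j k t x y
    = A_coeff i j k * (y $ i / (y $ j * y $ k))"
proof -
  note nz = nonzero_coord[OF assms(2)]
  have S: "sqrt (G1111 y) \<noteq> 0"
    using assms(2) by simp
  \<comment> \<open>the letters \<open>e\<close> to \<open>c'\<close> stand for the Kronecker factors of \<open>g_up\<close> and \<open>pd_y\<close>\<close>
  have term_eq: "2 * e * y $ i * y $ m / sqrt (G1111 y) / 2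
      * (a * a' * sqrt (G1111 y) / (16 * y $ j * y $ m * y $ k)
       + b * b' * sqrt (G1111 y) / (16 * y $ k * y $ m * y $ j)
       - c * c' * sqrt (G1111 y) / (16 * y $ j * y $ k * y $ m))
    = e / 16 * (a * a' + b * b' - c * c') * (y $ i / (y $ j * y $ k))"
    for e a a' b b' c c' :: real and m
  proof -
    define d where "d = a * a' + b * b' - c * c'"
    define w where "w = sqrt (G1111 y) / (16 * y $ j * y $ m * y $ k)"
    have "a * a' * sqrt (G1111 y) / (16 * y $ j * y $ m * y $ k)
       + b * b' * sqrt (G1111 y) / (16 * y $ k * y $ m * y $ j)
       - c * c' * sqrt (G1111 y) / (16 * y $ j * y $ k * y $ m) = d * w"
      by (simp add: d_def w_def algebra_simps add_divide_distrib diff_divide_distrib)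
    moreover have "2 * e * y $ i * y $ m / sqrt (G1111 y) / 2 * (d * w)
        = e / 16 * d * (y $ i / (y $ j * y $ k))"
      using nz S by (simp add: w_def)
    ultimately show ?thesis by (simp only: d_def)
  qed
  show ?thesis
    unfolding cartan_connection_def linear_connection.simps g_up_berwald_moor[of h t y, OF assms]
      pd_y_g_low[of h t y, OF assms] term_eq
    by (simp only: A_coeff_sum flip: sum_distrib_right)
qed

theorem theorem4p1:
  fixes h :: "real \<Rightarrow> real" and C\<Gamma> :: linear_connection
  assumes "smooth h" and "\<And>t. h t > 0"
  defines "C\<Gamma> \<equiv> cartan_connection (Gamma_ring h) h (berwald_moor h)"
  shows "\<forall>(t::real) (x::real ^ 4) (y::real ^ 4). G1111 y > 0 \<longrightarrow>
      conn_H C\<Gamma> t x y = christoffel h t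
    \<and> (\<forall>j k. conn_G C\<Gamma> k j t x y = 0)
    \<and> (\<forall>i j k. conn_L C\<Gamma> i j k t x y = christoffel h t / 3 * conn_C C\<Gamma> i j k t x y)
    \<and> (\<forall>i j k. conn_C C\<Gamma> i j k t x y = A_coeff i j k * (y $ i / (y $ j * y $ k)))"
proof (intro allI impI conjI)
  fix t and x y :: "real ^ 4"
  assume y: "G1111 y > 0"
  show "conn_H C\<Gamma> t x y = christoffel h t"
    by (simp add: C\<Gamma>_def cartan_connection_def)
  show "conn_G C\<Gamma> k j t x y = 0" for j k
    using assms(2) y by (simp add: C\<Gamma>_def cartan_connection_def delta_t_g_low)
  show "conn_L C\<Gamma> i j k t x y = christoffel h t / 3 * conn_C C\<Gamma> i j k t x y" for i j k
  proof -
    have "a / 2 * (c * p + c * q - c * r) = c * (a / 2 * (p + q - r))" for a c p q r :: real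
      by (simp add: algebra_simps)
    then show ?thesis
      unfolding C\<Gamma>_def cartan_connection_def linear_connection.simps
        delta_x_g_low[of h _ y, OF assms(2) y] sum_distrib_left
      by (simp only:)
  qed
  show "conn_C C\<Gamma> i j k t x y = A_coeff i j k * (y $ i / (y $ j * y $ k))" for i j k
    unfolding C\<Gamma>_def using assms(2) y by (rule conn_C_berwald_moor)
qed

end
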